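(* Let $P\in N_1$ be a sum of $10$ monomials, not necessarily distinct (i.e. $P(1)=10$). If $P$ does not have unique factorisation inside $N_1$, then one of the following holds. (A) There are integers $c\ge0$, $d\ge1$ such that $P(X)=X^cQ(X^d)$, where $Q$ is one of $Q_1=(1+X)(1+X^2+X^4+X^6+X^8)=(1+X^5)(1+X+X^2+X^3+X^4)$, $Q_2=(1+X)(1+X^4+X^6+X^8+X^{12})=(1+X^5)(1+X+X^4+X^7+X^8)$, $Q_3=(1+X^3)(1+X^2+X^4+X^6+X^8)=(1+X^5)(1+X^2+X^3+X^4+X^6)$. (B) There are integers $c\ge0$, $a\ge0$, $b\ge1$ such that $P=X^c\cdot F$, where $F$ is one of $(1+X^{3b})(1+X^a+X^b+X^{a+b}+X^{a+2b})=(1+X^b)(1+X^a+X^{a+2b}+X^{3b}+X^{a+4b})$, $(1+X^{3b})(1+X^a+X^b+X^{a+b}+X^{2b})=(1+X^b)(1+X^a+X^{2b}+X^{a+3b}+X^{4b})$.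
   Context: $N_1=\mathbb{Z}_{\ge0}[X]$ is the semiring of univariate polynomials with nonnegative integer coefficients. An element $Q\neq0,1$ of $N_1$ is irreducible if in every factorisation $Q=ST$ with $S,T\in N_1$ one of $S,T$ is $1$. $P$ has unique factorisation in $N_1$ if any two factorisations of $P$ into irreducibles of $N_1$ coincide up to order of the factors. *)

theory Defs
  imports "HOL-Computational_Algebra.Polynomial" "HOL-Library.Multiset"
begin

text \<open>N_1 = Z_{\<ge>0}[X] is modelled as the type nat poly.\<close>

definition N1_irreducible :: "nat poly \<Rightarrow> bool" where
  "N1_irreducible Q \<longleftrightarrow> Q \<noteq> 0 \<and> Q \<noteq> 1 \<and> (\<forall>S T. Q = S * T \<longrightarrow> S = 1 \<or> T = 1)"

definition N1_unique_factorisation :: "nat poly \<Rightarrow> bool" where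
  "N1_unique_factorisation P \<longleftrightarrow>
     (\<forall>A B :: nat poly multiset.
        (\<forall>x\<in>#A. N1_irreducible x) \<and> (\<forall>x\<in>#B. N1_irreducible x) \<and>
        prod_mset A = P \<and> prod_mset B = P \<longrightarrow> A = B)"

abbreviation Xp :: "nat \<Rightarrow> nat poly" where
  "Xp n \<equiv> monom 1 n"

definition Q1 :: "nat poly" where
  "Q1 = (1 + Xp 1) * (1 + Xp 2 + Xp 4 + Xp 6 + Xp 8)"
definition Q2 :: "nat poly" where
  "Q2 = (1 + Xp 1) * (1 + Xp 4 + Xp 6 + Xp 8 + Xp 12)"
definition Q3 :: "nat poly" where
  "Q3 = (1 + Xp 3) * (1 + Xp 2 + Xp 4 + Xp 6 + Xp 8)"

definition F1 :: "nat \<Rightarrow> nat \<Rightarrow> nat poly" where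
  "F1 a b = (1 + Xp (3*b)) * (1 + Xp a + Xp b + Xp (a+b) + Xp (a+2*b))"
definition F2 :: "nat \<Rightarrow> nat \<Rightarrow> nat poly" where
  "F2 a b = (1 + Xp (3*b)) * (1 + Xp a + Xp b + Xp (a+b) + Xp (2*b))"

end

theory Submission
  imports Defs
begin

text \<open>After splitting off a power of \<open>X\<close>, evaluation at \<open>1\<close> shows that two different
  factorisations have the form \<open>(1 + X\<^sup>m) B = (1 + X\<^sup>n) D\<close> with \<open>B(1) = D(1) = 5\<close>, \<open>m < n\<close>, and
  \<open>m > 0\<close> because \<open>2\<close> does not divide \<open>D(1)\<close>. The ten exponents are thus matched in pairs at
  distance \<open>m\<close>, and also in pairs at distance \<open>n\<close>; the two matchings together form closed
  alternating walks. If a walk has \<open>j\<close> edges of each kind, then \<open>a m + b n = 0\<close> for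
  some \<open>a \<equiv> b \<equiv> j (mod 2)\<close> with \<open>\<bar>a\<bar>, \<bar>b\<bar> \<le> j\<close>. For odd \<open>j \<le> 5\<close> this forces \<open>m : n\<close>
  to be \<open>1:3\<close>, \<open>1:5\<close> or \<open>3:5\<close>, with \<open>j = 5\<close> in the last two cases. Hence the five edges of each
  kind lie on one walk, or they split as \<open>2 + 3\<close>, and only finitely many sign
  patterns remain.\<close>

section \<open>Multisets paired with their translates\<close>

text \<open>If \<open>B\<close> lists the exponents of a polynomial, this lists those of its product
  with \<open>1 + X^m\<close>. The type is general because walks need subtraction and live in
  \<open>int\<close>, while exponents are \<open>nat\<close>.\<close>

definition add_shift :: "'a::ab_semigroup_add \<Rightarrow> 'a multiset \<Rightarrow> 'a multiset" where
  "add_shift m B = B + image_mset ((+) m) B"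

lemma add_shift_add [simp]: "add_shift m (A + B) = add_shift m A + add_shift m B"
  by (simp add: add_shift_def)

lemma add_shift_empty [simp]: "add_shift m {#} = {#}"
  by (simp add: add_shift_def)

lemma add_shift_add_mset [simp]:
  "add_shift m (add_mset x A) = add_mset x (add_mset (m + x) (add_shift m A))"
  by (simp add: add_shift_def)

lemma size_add_shift: "size (add_shift m A) = 2 * size A"
  by (simp add: add_shift_def)

lemma add_shift_mono: "A \<subseteq># B \<Longrightarrow> add_shift m A \<subseteq># add_shift m B"
  by (simp add: add_shift_def image_mset_subseteq_mono subset_mset.add_mono)

lemma add_shift_diff: "A \<subseteq># B \<Longrightarrow> add_shift m (B - A) = add_shift m B - add_shift m A"
  by (metis add_diff_cancel_left' add_shift_add subset_mset.add_diff_inverse)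

section \<open>Alternating walks and their closure\<close>

text \<open>A pair \<open>(e, f)\<close> stands for a step by \<open>\<plusminus>m\<close> followed by a step by \<open>\<plusminus>n\<close>,
  with sign \<open>+\<close> for \<open>True\<close>. The functions \<open>low_m\<close> and \<open>low_n\<close> collect the lower
  end points of the edges of length \<open>m\<close> and \<open>n\<close>.\<close>

fun walk_step :: "int \<Rightarrow> int \<Rightarrow> int \<Rightarrow> bool \<times> bool \<Rightarrow> int" where
  "walk_step m n x (e, f) = x + (if e then m else - m) + (if f then n else - n)"

fun walk_end :: "int \<Rightarrow> int \<Rightarrow> int \<Rightarrow> (bool \<times> bool) list \<Rightarrow> int" where
  "walk_end m n x [] = x"
| "walk_end m n x (p # s) = walk_end m n (walk_step m n x p) s"

fun low_m :: "int \<Rightarrow> int \<Rightarrow> int \<Rightarrow> (bool \<times> bool) list \<Rightarrow> int list" where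
  "low_m m n x [] = []"
| "low_m m n x (p # s) = (if fst p then x else x - m) # low_m m n (walk_step m n x p) s"

fun low_n :: "int \<Rightarrow> int \<Rightarrow> int \<Rightarrow> (bool \<times> bool) list \<Rightarrow> int list" where
  "low_n m n x [] = []"
| "low_n m n x (p # s) =
    (let y = x + (if fst p then m else - m) in if snd p then y else y - n)
      # low_n m n (walk_step m n x p) s"

lemma length_low [simp]: "length (low_m m n x s) = length s" "length (low_n m n x s) = length s"
  by (induction s arbitrary: x) auto

text \<open>Every vertex strictly inside the walk ends one \<open>m\<close>-edge and one
  \<open>n\<close>-edge. Only the start lacks an \<open>n\<close>-edge and only the end lacks an
  \<open>m\<close>-edge, counted with multiplicity.\<close>

lemma walk_balance:
  "add_mset (walk_end m n x s) (add_shift m (mset (low_m m n x s))) =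
    add_mset x (add_shift n (mset (low_n m n x s)))"
proof (induction s arbitrary: x)
  case (Cons p s)
  obtain e f where p: "p = (e, f)" by (cases p)
  show ?case
    using Cons.IH[of "walk_step m n x p"]
    by (cases e; cases f) (simp_all add: p Let_def add_mset_commute algebra_simps)
qed auto

lemma uncovered_edge:
  fixes m :: int
  assumes "A \<subseteq># B" "count (add_shift m A) x < count (add_shift m B) x"
  shows "\<exists>e. add_mset (if e then x else x - m) A \<subseteq># B"
proof -
  obtain C where C: "B = A + C" using assms(1) by (metis subset_mset.add_diff_inverse)
  with assms have "x \<in># add_shift m C" by simp
  then have "x \<in># C \<or> x - m \<in># C" by (auto simp: add_shift_def)
  then show ?thesis
    by (metis C add_mset_add_single mset_subset_eq_mono_add_left_cancel single_subset_iff)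
qed

text \<open>The walk grows backwards at its start: a free \<open>n\<close>-edge leads from
  \<open>x\<close> to \<open>y\<close>, and a parity-style count at \<open>y\<close> then yields a
  free \<open>m\<close>-edge.\<close>

lemma walk_extend:
  assumes eq: "add_shift m B = add_shift n D"
    and sub: "mset (low_m m n x s) \<subseteq># B" "mset (low_n m n x s) \<subseteq># D"
    and lt: "count (add_shift n (mset (low_n m n x s))) x < count (add_shift m B) x"
  shows "\<exists>w p. walk_end m n w (p # s) = walk_end m n x s \<and>
    mset (low_m m n w (p # s)) \<subseteq># B \<and> mset (low_n m n w (p # s)) \<subseteq># D"
proof -
  obtain f' where f': "add_mset (if f' then x else x - n) (mset (low_n m n x s)) \<subseteq># D"
    using uncovered_edge[OF sub(2), of n x] lt eq by auto
  define y where "y = (if f' then x + n else x - n)"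
  \<comment> \<open>With the new \<open>n\<close>-edge included, \<open>walk_balance\<close> shows
    that \<open>y\<close> meets strictly more used \<open>n\<close>-edges than used
    \<open>m\<close>-edges.\<close>
  have "count (add_shift m (mset (low_m m n x s))) y
      < count (add_mset y (add_mset (walk_end m n x s) (add_shift m (mset (low_m m n x s))))) y"
    by simp
  also have "\<dots> = count (add_shift n (add_mset (if f' then x else x - n) (mset (low_n m n x s)))) y"
    by (simp add: walk_balance y_def algebra_simps)
  also have "\<dots> \<le> count (add_shift m B) y"
    unfolding eq using add_shift_mono[OF f'] by (rule mset_subset_eq_count)
  finally obtain e' where e': "add_mset (if e' then y else y - m) (mset (low_m m n x s)) \<subseteq># B"
    using uncovered_edge[OF sub(1)] by blast
  define w where "w = (if e' then y + m else y - m)"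
  \<comment> \<open>The new edges are found going from \<open>x\<close> to \<open>w\<close> but are
    walked from \<open>w\<close> to \<open>x\<close>, hence the negated signs.\<close>
  have "walk_step m n w (\<not> e', \<not> f') = x" by (simp add: w_def y_def)
  with e' f' show ?thesis
    by (intro exI[of _ w] exI[of _ "(\<not> e', \<not> f')"])
       (auto simp: w_def y_def Let_def split: if_splits)
qed

text \<open>A walk ending at \<open>z\<close> whose start differs from \<open>z\<close> can always
  be extended backwards without reusing an edge. As \<open>B\<close> is finite, the start must at
  some point return to \<open>z\<close>.\<close>

lemma closed_walk_exists:
  assumes eq: "add_shift m B = add_shift n D" and z: "z \<in># add_shift m B"
  shows "\<exists>s. s \<noteq> [] \<and> walk_end m n z s = z \<and>
    mset (low_m m n z s) \<subseteq># B \<and> mset (low_n m n z s) \<subseteq># D"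
proof (rule ccontr)
  assume no: "\<not> ?thesis"
  have "\<exists>s x. length s = k \<and> walk_end m n x s = z \<and>
    mset (low_m m n x s) \<subseteq># B \<and> mset (low_n m n x s) \<subseteq># D" for k
  proof (induction k)
    case (Suc k)
    then obtain s x where s: "length s = k" "walk_end m n x s = z"
      "mset (low_m m n x s) \<subseteq># B" "mset (low_n m n x s) \<subseteq># D" by blast
    have "count (add_shift n (mset (low_n m n x s))) x < count (add_shift m B) x"
    proof (cases "s = []")
      case True
      then show ?thesis using s(2) z by simp
    next
      case False
      then have "x \<noteq> z" using no s by blast
      \<comment> \<open>As \<open>x\<close> is the start but not the end,
        \<open>walk_balance\<close> gives it one more used \<open>m\<close>-edge than used
        \<open>n\<close>-edges.\<close>
      then have "count (add_shift n (mset (low_n m n x s))) x < count (add_shift m (mset (low_m m n x s))) x"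
        using arg_cong[OF walk_balance[of m n x s], of "\<lambda>M. count M x"] s(2) by simp
      also have "\<dots> \<le> count (add_shift m B) x"
        using add_shift_mono[OF s(3)] by (rule mset_subset_eq_count)
      finally show ?thesis .
    qed
    from walk_extend[OF eq s(3,4) this] s(1,2) show ?case by (metis length_Cons)
  qed auto
  then obtain s x where "length s = Suc (size B)" "mset (low_m m n x s) \<subseteq># B" by blast
  then show False using size_mset_mono by fastforce
qed

text \<open>The bounds on the lower end points make \<open>z\<close> a least vertex of the walk.
  This normalises the starting point, so that few sign patterns survive the enumeration.\<close>

definition closed_walk :: "int \<Rightarrow> int \<Rightarrow> int \<Rightarrow> (bool \<times> bool) list \<Rightarrow> bool" where
  "closed_walk m n z s \<longleftrightarrow> walk_end m n z s = z \<and>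
    list_all ((\<le>) z) (low_m m n z s) \<and> list_all ((\<le>) z) (low_n m n z s)"

text \<open>A closed walk uses balanced sets of edges, so what remains after its removal is balanced
  again.\<close>

lemma split_closed_walk:
  assumes eq: "add_shift m B = add_shift n D" and "B \<noteq> {#}"
  obtains z s B' D' where "s \<noteq> []" "closed_walk m n z s" "B = mset (low_m m n z s) + B'"
    "add_shift m B' = add_shift n D'"
proof -
  \<comment> \<open>Starting at the least vertex of all gives the bounds required by
    \<open>closed_walk\<close>.\<close>
  define z where "z = Min_mset (add_shift m B)"
  have "add_shift m B \<noteq> {#}" using assms(2) by (simp add: add_shift_def)
  then have z: "z \<in># add_shift m B" unfolding z_def by (intro Min_in) auto
  have le: "z \<le> x" if "x \<in># B + D" for x
  proof -
    have "x \<in># add_shift m B"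
      using that eq by (metis add_shift_def union_iff)
    then show ?thesis by (simp add: z_def)
  qed
  obtain s where s: "s \<noteq> []" "walk_end m n z s = z"
    "mset (low_m m n z s) \<subseteq># B" "mset (low_n m n z s) \<subseteq># D"
    using closed_walk_exists[OF eq z] by blast
  show thesis
  proof (rule that[of s z "B - mset (low_m m n z s)" "D - mset (low_n m n z s)"])
    show "closed_walk m n z s"
      using s le unfolding closed_walk_def list_all_iff
      by (metis mset_subset_eqD set_mset_mset union_iff)
    show "add_shift m (B - mset (low_m m n z s)) = add_shift n (D - mset (low_n m n z s))"
      using walk_balance[of m n z s] s eq by (simp add: add_shift_diff)
  qed (use s in auto)
qed

section \<open>Displacement and rescaling of walks\<close>

lemma walk_end_shift: "walk_end m n x s = x + walk_end m n 0 s"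
proof (induction s arbitrary: x)
  case (Cons p s)
  have "walk_step m n x p = x + walk_step m n 0 p" by (cases p) auto
  then show ?case using Cons[of "walk_step m n x p"] Cons[of "walk_step m n 0 p"] by simp
qed auto

text \<open>\<open>walk_end 1 0 0 s\<close> and \<open>walk_end 0 1 0 s\<close> are the sums of the
  signs of the \<open>m\<close>-steps and of the \<open>n\<close>-steps.\<close>

lemma walk_end_linear: "walk_end m n x s = x + m * walk_end 1 0 0 s + n * walk_end 0 1 0 s"
proof (induction s arbitrary: x)
  case (Cons p s)
  have "walk_step m n x p = x + m * walk_step 1 0 0 p + n * walk_step 0 1 0 p" by (cases p) auto
  then show ?case
    using Cons.IH[of "walk_step m n x p"] walk_end_shift[of 1 0 "walk_step 1 0 0 p" s]
      walk_end_shift[of 0 1 "walk_step 0 1 0 p" s]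
    by (simp add: algebra_simps)
qed auto

text \<open>With steps \<open>p * d\<close> and \<open>q * d\<close> the walk stays in one
  arithmetic progression of difference \<open>d\<close>, and its positions there form a walk with
  steps \<open>p\<close> and \<open>q\<close>.\<close>

lemma low_scale:
  "low_m (p * d) (q * d) (z + k * d) s = map (\<lambda>k. z + k * d) (low_m p q k s)"
  "low_n (p * d) (q * d) (z + k * d) s = map (\<lambda>k. z + k * d) (low_n p q k s)"
  "walk_end (p * d) (q * d) (z + k * d) s = z + walk_end p q k s * d"
proof -
  have "low_m (p * d) (q * d) (z + k * d) s = map (\<lambda>k. z + k * d) (low_m p q k s) \<and>
    low_n (p * d) (q * d) (z + k * d) s = map (\<lambda>k. z + k * d) (low_n p q k s) \<and>
    walk_end (p * d) (q * d) (z + k * d) s = z + walk_end p q k s * d"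
  proof (induction s arbitrary: k)
    case (Cons r s)
    obtain e f where r: "r = (e, f)" by (cases r)
    have "walk_step (p * d) (q * d) (z + k * d) r = z + walk_step p q k r * d"
      by (simp add: r algebra_simps)
    then show ?case
      by (simp add: Cons Let_def) (auto simp: r algebra_simps)
  qed auto
  then show "low_m (p * d) (q * d) (z + k * d) s = map (\<lambda>k. z + k * d) (low_m p q k s)"
    "low_n (p * d) (q * d) (z + k * d) s = map (\<lambda>k. z + k * d) (low_n p q k s)"
    "walk_end (p * d) (q * d) (z + k * d) s = z + walk_end p q k s * d" by auto
qed

lemma closed_walk_scale:
  assumes "d > 0" "closed_walk (p * d) (q * d) z s"
  shows "closed_walk p q 0 s" "low_m (p * d) (q * d) z s = map (\<lambda>k. z + k * d) (low_m p q 0 s)"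
proof -
  note sc = low_scale[of p d q z 0, simplified]
  show "low_m (p * d) (q * d) z s = map (\<lambda>k. z + k * d) (low_m p q 0 s)" by (rule sc)
  show "closed_walk p q 0 s"
    using assms unfolding closed_walk_def sc by (auto simp: list_all_iff zero_le_mult_iff)
qed

section \<open>Closed walks with an odd number of edges of each kind\<close>

abbreviation sign_lists :: "nat \<Rightarrow> (bool \<times> bool) list list" where
  "sign_lists j \<equiv> List.n_lists j [(True, True), (True, False), (False, True), (False, False)]"

lemma in_sign_lists: "length s = j \<Longrightarrow> s \<in> set (sign_lists j)"
  by (auto simp: set_n_lists)

text \<open>One of \<open>p\<close>, \<open>q\<close> is \<open>1\<close> and the other
  \<open>0\<close>, so the displacement is a sum of \<open>length s\<close> signs.\<close>

lemma walk_end_unit: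
  assumes "p \<ge> 0" "q \<ge> 0" "p + q = 1"
  shows "\<bar>walk_end p q x s - x\<bar> \<le> int (length s) \<and> (even (walk_end p q x s - x) \<longleftrightarrow> even (length s))"
proof (induction s arbitrary: x)
  case (Cons r s)
  from assms consider "p = 1" "q = 0" | "p = 0" "q = 1" by linarith
  then have "\<bar>walk_step p q x r - x\<bar> \<le> 1 \<and> odd (walk_step p q x r - x)"
    by cases (cases r, force)+
  then show ?case using Cons[of "walk_step p q x r"] by auto
qed auto

text \<open>Here \<open>m * \<bar>a\<bar> = n * \<bar>b\<bar>\<close> forces
  \<open>\<bar>b\<bar> < \<bar>a\<bar> \<le> 5\<close>. Two odd numbers then leave only the pairs
  (3,1), (5,1) and (5,3).\<close>

lemma odd_signed_sum_zero:
  fixes m n a b :: int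
  assumes "0 < m" "m < n" "m * a + n * b = 0" "odd a" "odd b" "\<bar>a\<bar> \<le> 5"
  shows "n = 3 * m \<and> 3 \<le> \<bar>a\<bar> \<or> n = 5 * m \<and> 5 \<le> \<bar>a\<bar> \<or> 5 * m = 3 * n \<and> 5 \<le> \<bar>a\<bar>"
proof -
  have eq: "m * \<bar>a\<bar> = n * \<bar>b\<bar>"
    using assms by (metis abs_minus_cancel abs_mult abs_of_pos add_eq_0_iff less_trans)
  have "\<bar>b\<bar> < \<bar>a\<bar>"
  proof (rule ccontr)
    assume "\<not> \<bar>b\<bar> < \<bar>a\<bar>"
    then have "m * \<bar>a\<bar> \<le> m * \<bar>b\<bar>" using assms by simp
    also have "\<dots> < n * \<bar>b\<bar>" using assms by (auto intro: mult_strict_right_mono)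
    finally show False using eq by simp
  qed
  moreover have "odd \<bar>a\<bar>" "odd \<bar>b\<bar>" using assms by auto
  ultimately have "(\<bar>a\<bar>, \<bar>b\<bar>) \<in> {(3, 1), (5, 1), (5, 3)}"
    using assms(6) by simp presburger
  then show ?thesis using eq by auto
qed

text \<open>The ratio is stated through a common unit \<open>d\<close>, including the factor in
  \<open>1 * d\<close>, to match the form needed for rescaling.\<close>

lemma odd_closed_walk:
  assumes "0 < m" "m < n" "closed_walk m n z s" "odd (length s)" "length s \<le> 5"
  obtains d where "d > 0" "m = 1 * d" "n = 3 * d" "3 \<le> length s"
  | d where "d > 0" "m = 1 * d" "n = 5 * d" "5 \<le> length s"
  | d where "d > 0" "m = 3 * d" "n = 5 * d" "5 \<le> length s"
proof -
  define a where "a = walk_end 1 0 0 s"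
  define b where "b = walk_end 0 1 0 s"
  have "m * a + n * b = 0"
    using assms(3) walk_end_linear[of m n z s] by (simp add: closed_walk_def a_def b_def)
  moreover have "odd a" "odd b" "\<bar>a\<bar> \<le> int (length s)"
    using walk_end_unit[of 1 0 0 s] walk_end_unit[of 0 1 0 s] assms(4) by (auto simp: a_def b_def)
  ultimately consider "n = 3 * m" "3 \<le> \<bar>a\<bar>" | "n = 5 * m" "5 \<le> \<bar>a\<bar>" | "5 * m = 3 * n" "5 \<le> \<bar>a\<bar>"
    using odd_signed_sum_zero[of m n a b] assms by fastforce
  then show thesis
  proof cases
    case 3
    \<comment> \<open>The unit \<open>d\<close> is \<open>2 * m - n\<close>, because
      \<open>6 * d - 5 * d = d\<close>.\<close>
    then have "m = 3 * (2 * m - n)" "n = 5 * (2 * m - n)" "5 \<le> length s" "2 * m - n > 0"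
      using assms(1) \<open>\<bar>a\<bar> \<le> int (length s)\<close> by auto
    then show ?thesis using that(3) by blast
  qed (use that(1,2)[of m] assms(1) \<open>\<bar>a\<bar> \<le> int (length s)\<close> in auto)
qed

text \<open>Rescaling moves the walk to start \<open>0\<close> and steps \<open>p\<close>,
  \<open>q\<close>, where the last hypothesis is a finite check by evaluation. Sorting discards the
  order of the visits.\<close>

lemma closed_walk_sort:
  assumes "d > 0" "closed_walk (p * d) (q * d) z s" "length s = j"
    and "list_all (\<lambda>s. sort (low_m p q 0 s) \<in> K) (filter (closed_walk p q 0) (sign_lists j))"
  shows "\<exists>ks \<in> K. mset (low_m (p * d) (q * d) z s) = image_mset (\<lambda>k. z + k * d) (mset ks)"
proof (rule bexI)
  show "sort (low_m p q 0 s) \<in> K"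
    using assms(4) closed_walk_scale(1)[OF assms(1,2)] in_sign_lists[OF assms(3)]
    by (auto simp: list_all_iff)
  show "mset (low_m (p * d) (q * d) z s) =
      image_mset (\<lambda>k. z + k * d) (mset (sort (low_m p q 0 s)))"
    by (simp add: closed_walk_scale(2)[OF assms(1,2)])
qed

lemma walks_13_3: "list_all (\<lambda>s. sort (low_m 1 3 0 s) \<in> {[0, 2, 4]})
  (filter (closed_walk 1 3 0) (sign_lists 3))"
  by code_simp

text \<open>In units of \<open>b\<close>, these are the exponents of the cofactors of
  \<open>1 + X^b\<close> in the two families of case (B). A single walk allows only small integers
  \<open>a\<close>.\<close>

lemma walks_13_5: "list_all (\<lambda>s. sort (low_m 1 3 0 s) \<in>
   (\<lambda>a. sort [0, a, a + 2, 3, a + 4]) ` set [0..4] \<union> (\<lambda>a. sort [0, a, 2, a + 3, 4]) ` set [0..5])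
  (filter (closed_walk 1 3 0) (sign_lists 5))"
  by code_simp

text \<open>The exponents of the cofactors of \<open>1 + X\<close> in \<open>Q1\<close> and
  \<open>Q2\<close>.\<close>

lemma walks_15_5: "list_all (\<lambda>s. sort (low_m 1 5 0 s) \<in>
   {[0, 2, 4, 6, 8], [0, 4, 6, 8, 12]})
  (filter (closed_walk 1 5 0) (sign_lists 5))"
  by code_simp

text \<open>The exponents of the cofactor of \<open>1 + X^3\<close> in \<open>Q3\<close>.\<close>

lemma walks_35_5: "list_all (\<lambda>s. sort (low_m 3 5 0 s) \<in> {[0, 2, 4, 6, 8]})
  (filter (closed_walk 3 5 0) (sign_lists 5))"
  by code_simp

section \<open>Balanced multisets of two, three and five edges\<close>

text \<open>Minimality of \<open>z\<close> forces the first two steps upwards, and closure forces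
  the other two downwards: the walk goes around \<open>z\<close>, \<open>z + m\<close>,
  \<open>z + m + n\<close>, \<open>z + n\<close>.\<close>

lemma two_step_closed_walk:
  assumes "0 < m" "m < n" "closed_walk m n z s" "length s = 2"
  shows "mset (low_m m n z s) = {#z, z + n#}"
proof -
  obtain e f g h where s: "s = [(e, f), (g, h)]"
    using assms(4) by (auto simp: length_Suc_conv numeral_2_eq_2)
  show ?thesis
    using assms(1-3) by (cases e; cases f; cases g; cases h)
      (auto simp: s closed_walk_def Let_def)
qed

lemma no_singleton:
  assumes "0 < m" "m < (n :: int)" "add_shift m B = add_shift n D" shows "size B \<noteq> 1"
proof
  assume "size B = 1"
  moreover from this have "size D = 1" using arg_cong[OF assms(3), of size] by (simp add: size_add_shift)
  ultimately obtain b d where "B = {#b#}" "D = {#d#}" by (metis size_1_singleton_mset)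
  with assms show False by (auto simp: add_eq_conv_ex)
qed

lemma closed_walk_length:
  assumes "0 < m" "m < n" "closed_walk m n z s" "s \<noteq> []"
  shows "2 \<le> length s"
proof (rule ccontr)
  assume "\<not> 2 \<le> length s"
  moreover have "length s > 0" using assms(4) by simp
  ultimately have l: "length s = 1" by linarith
  show False
    by (rule odd_closed_walk[OF assms(1-3)]) (use l in auto)
qed

lemma balanced_2:
  fixes m n :: int
  assumes mn: "0 < m" "m < n" and eq: "add_shift m B = add_shift n D" and size: "size B = 2"
  shows "\<exists>u. B = {#u, u + n#}"
proof -
  have "B \<noteq> {#}" using size by auto
  then obtain z s B' D' where s: "s \<noteq> []" "closed_walk m n z s"
    "B = mset (low_m m n z s) + B'" "add_shift m B' = add_shift n D'"
    by (rule split_closed_walk[OF eq])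
  have "size B = length s + size B'" by (simp add: s(3))
  moreover have "2 \<le> length s" using closed_walk_length[OF mn s(2,1)] .
  ultimately have "length s = 2" "size B' = 0"
    using size by linarith+
  then show ?thesis using two_step_closed_walk[OF mn s(2)] s(3) by auto
qed

text \<open>A walk with two edges of each kind would leave a single edge, so one walk uses all
  three.\<close>

lemma balanced_3:
  fixes m n :: int
  assumes mn: "0 < m" "m < n" and eq: "add_shift m B = add_shift n D" and size: "size B = 3"
  shows "n = 3 * m \<and> (\<exists>v. B = {#v, v + 2 * m, v + 4 * m#})"
proof -
  have "B \<noteq> {#}" using size by auto
  then obtain z s B' D' where s: "s \<noteq> []" "closed_walk m n z s"
    "B = mset (low_m m n z s) + B'" "add_shift m B' = add_shift n D'"
    by (rule split_closed_walk[OF eq])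
  have "size B = length s + size B'" by (simp add: s(3))
  moreover have "2 \<le> length s" using closed_walk_length[OF mn s(2,1)] .
  ultimately have l: "length s = 3" and "size B' = 0"
    using size no_singleton[OF mn s(4)] by linarith+
  then have B: "B = mset (low_m m n z s)" using s(3) by simp
  obtain d where d: "d > 0" "m = 1 * d" "n = 3 * d"
    by (rule odd_closed_walk[OF mn s(2)]) (use l in auto)
  then show ?thesis
    using closed_walk_sort[OF d(1) s(2)[unfolded d(2,3)] l walks_13_3] B by (auto simp: algebra_simps)
qed

text \<open>The first outcome leads to case (A). The other two form case (B), arising from a split
  \<open>2 + 3\<close> or from a single walk with \<open>n = 3 * m\<close>.\<close>

lemma balanced_5:
  fixes m n :: int
  assumes mn: "0 < m" "m < n" and eq: "add_shift m B = add_shift n D" and size: "size B = 5"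
  obtains ks z d where "d > 0" "B = image_mset (\<lambda>k. z + k * d) (mset ks)"
    "m = d \<and> ks \<in> {[0, 2, 4, 6, 8], [0, 4, 6, 8, 12]} \<or> m = 3 * d \<and> ks = [0, 2, 4, 6, 8]"
  | z a where "a \<ge> 0" "B = {#z, z + a, z + a + 2 * m, z + 3 * m, z + a + 4 * m#}"
  | z a where "a \<ge> 0" "B = {#z, z + a, z + 2 * m, z + a + 3 * m, z + 4 * m#}"
proof -
  note result = that
  have "B \<noteq> {#}" using size by auto
  then obtain z s B' D' where s: "s \<noteq> []" "closed_walk m n z s"
    "B = mset (low_m m n z s) + B'" "add_shift m B' = add_shift n D'"
    by (rule split_closed_walk[OF eq])
  have sz: "size B = length s + size B'" by (simp add: s(3))
  have l: "2 \<le> length s" using closed_walk_length[OF mn s(2,1)] .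
  \<comment> \<open>\<open>u\<close> starts the pair and \<open>v\<close> the triple. Which of them
    is smaller decides between the two families, with \<open>a\<close> their distance.\<close>
  have two_three: thesis if "n = 3 * m" "B = {#u, u + n#} + {#v, v + 2 * m, v + 4 * m#}" for u v
  proof (cases "u \<le> v")
    case True
    then show thesis using that
      by (intro result(2)[of "v - u" u]) (auto simp: add_mset_commute algebra_simps)
  next
    case False
    then show thesis using that
      by (intro result(3)[of "u - v" v]) (auto simp: add_mset_commute algebra_simps)
  qed
  \<comment> \<open>Length 4 would leave a single edge.\<close>
  consider "length s = 2" "size B' = 3" | "length s = 3" "size B' = 2" | "length s = 5" "size B' = 0"
    using sz size l no_singleton[OF mn s(4)] by linarith
  then show thesis
  proof cases
    case 1
    then show thesis
      using balanced_3[OF mn s(4)] two_step_closed_walk[OF mn s(2)] s(3) two_three by metis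
  next
    case 2
    \<comment> \<open>The closed walk is balanced by itself, so \<open>balanced_3\<close> applies to
      it and \<open>balanced_2\<close> to the rest.\<close>
    have "add_shift m (mset (low_m m n z s)) = add_shift n (mset (low_n m n z s))"
      using walk_balance[of m n z s] s(2) by (simp add: closed_walk_def)
    then show thesis
      using balanced_3[OF mn, of "mset (low_m m n z s)"] balanced_2[OF mn s(4)] 2 s(3) two_three
      by (metis add.commute length_low(1) size_mset)
  next
    case 3
    then have B: "B = mset (low_m m n z s)" and l5: "length s \<le> 5" "odd (length s)"
      using s(3) by auto
    from odd_closed_walk[OF mn s(2) l5(2,1)] show thesis
    proof cases
      case (1 d)
      obtain ks where ks: "B = image_mset (\<lambda>k. z + k * d) (mset ks)"
        "(\<exists>a\<ge>0. ks = sort [0, a, a + 2, 3, a + 4]) \<or> (\<exists>a\<ge>0. ks = sort [0, a, 2, a + 3, 4])"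
        using closed_walk_sort[OF 1(1) s(2)[unfolded 1(2,3)] \<open>length s = 5\<close> walks_13_5]
        unfolding B 1(2,3) by fastforce
      from ks(2) show thesis
      proof (elim disjE exE conjE)
        fix a :: int assume "a \<ge> 0" "ks = sort [0, a, a + 2, 3, a + 4]"
        then show thesis using ks(1) 1
          by (intro result(2)[of "a * d" z]) (auto simp: algebra_simps simp del: sort_key_simps)
      next
        fix a :: int assume "a \<ge> 0" "ks = sort [0, a, 2, a + 3, 4]"
        then show thesis using ks(1) 1
          by (intro result(3)[of "a * d" z]) (auto simp: algebra_simps simp del: sort_key_simps)
      qed
    next
      case (2 d)
      obtain ks where "ks \<in> {[0, 2, 4, 6, 8], [0, 4, 6, 8, 12]}"
        "B = image_mset (\<lambda>k. z + k * d) (mset ks)"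
        using closed_walk_sort[OF 2(1) s(2)[unfolded 2(2,3)] \<open>length s = 5\<close> walks_15_5]
        unfolding B 2(2,3) by blast
      then show thesis using 2 by (intro result(1)[of d z ks]) auto
    next
      case (3 d)
      obtain ks where "ks \<in> {[0, 2, 4, 6, 8]}"
        "B = image_mset (\<lambda>k. z + k * d) (mset ks)"
        using closed_walk_sort[OF 3(1) s(2)[unfolded 3(2,3)] \<open>length s = 5\<close> walks_35_5]
        unfolding B 3(2,3) by blast
      then show thesis using 3 by (intro result(1)[of d z ks]) auto
    qed
  qed
qed

\<comment> \<open>otherwise the simplifier turns the coefficient in \<open>monom 1 n\<close> into \<open>Suc 0\<close>\<close>
declare One_nat_def [simp del]

section \<open>Polynomials as multisets of exponents\<close>

definition mset_poly :: "nat multiset \<Rightarrow> nat poly" where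
  "mset_poly M = (\<Sum>k\<in>#M. Xp k)"

lemma mset_poly_simps [simp]:
  "mset_poly {#} = 0"
  "mset_poly (add_mset k M) = Xp k + mset_poly M"
  "mset_poly (M + N) = mset_poly M + mset_poly N"
  by (simp_all add: mset_poly_def)

lemma coeff_mset_poly [simp]: "coeff (mset_poly M) k = count M k"
  by (induction M) auto

lemma mset_poly_eq_iff [simp]: "mset_poly M = mset_poly N \<longleftrightarrow> M = N"
  by (metis coeff_mset_poly multiset_eqI)

lemma poly_mset_poly_1 [simp]: "poly (mset_poly M) 1 = size M"
  by (induction M) (auto simp: poly_monom)

lemma mset_poly_surj: "\<exists>M. p = mset_poly M"
proof (induction p)
  case (pCons a p)
  then obtain M where p: "p = mset_poly M" by auto
  have "mset_poly (image_mset Suc M) = pCons 0 (mset_poly M)"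
    by (induction M) (auto simp: monom_Suc)
  moreover have "mset_poly (replicate_mset a 0) = [:a:]"
    by (rule poly_eqI) (simp add: coeff_pCons split: nat.split)
  ultimately have "pCons a p = mset_poly (replicate_mset a 0 + image_mset Suc M)"
    by (simp add: p)
  then show ?case by blast
qed (auto intro: exI[of _ "{#}"])

lemma Xp_mult_mset_poly: "Xp m * mset_poly M = mset_poly (image_mset ((+) m) M)"
  by (induction M) (auto simp: algebra_simps mult_monom)

lemma binomial_mult_mset_poly: "(1 + Xp m) * mset_poly B = mset_poly (add_shift m B)"
  by (simp add: distrib_right Xp_mult_mset_poly add_shift_def)

lemma Xp_mult_cancel [simp]: "Xp c * p = Xp c * q \<longleftrightarrow> p = q"
proof
  assume "Xp c * p = Xp c * q"
  then have "coeff (Xp c * p) (c + k) = coeff (Xp c * q) (c + k)" for k by simp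
  then show "p = q" by (simp add: coeff_monom_mult poly_eq_iff)
qed simp

lemma count_image_plus: "count (image_mset ((+) m) B) (k :: nat) = (if m \<le> k then count B (k - m) else 0)"
  by (induction B) auto

lemma count_add_shift: "count (add_shift m B) k = count B k + (if m \<le> k then count B (k - m) else 0)" for m k :: nat
  by (simp add: add_shift_def count_image_plus)

text \<open>Cancellation of \<open>1 + X^m\<close>, comparing coefficients from the lowest
  upwards.\<close>

lemma add_shift_inject: "add_shift m B = add_shift m D \<longleftrightarrow> B = D" for m :: nat
proof
  assume eq: "add_shift m B = add_shift m D"
  have "count B k = count D k" for k
  proof (induction k rule: less_induct)
    case (less k)
    have "count (add_shift m B) k = count (add_shift m D) k" by (simp add: eq)
    then show ?case using less[of "k - m"] by (cases "m = 0") (auto simp: count_add_shift split: if_splits)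
  qed
  then show "B = D" by (rule multiset_eqI)
qed simp

text \<open>Modulo 2 the hypothesis says that \<open>1 + X^n\<close> times \<open>D\<close>
  vanishes, so all coefficients of \<open>D\<close> are even, from the lowest upwards.\<close>

lemma even_size_if_add_shift_0:
  fixes n :: nat
  assumes "n > 0" "add_shift 0 B = add_shift n D"
  shows "even (size D)"
proof -
  have "even (count D k)" for k
  proof (induction k rule: less_induct)
    case (less k)
    have "even (count (add_shift n D) k)" unfolding assms(2)[symmetric] by (simp add: count_add_shift)
    then show ?case using less[of "k - n"] assms(1) by (auto simp: count_add_shift split: if_splits)
  qed
  then show ?thesis by (simp add: size_multiset_overloaded_eq dvd_sum)
qed

lemma image_int_add_shift: "image_mset int (add_shift m B) = add_shift (int m) (image_mset int B)"
  by (simp add: add_shift_def multiset.map_comp comp_def)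

lemma mset_poly_balanced_5:
  fixes m n :: nat
  assumes "0 < m" "m < n" and eq: "add_shift m B = add_shift n D" and size: "size B = 5"
  shows "(\<exists>c d Q. d \<ge> 1 \<and> Q \<in> {Q1, Q2, Q3} \<and> mset_poly (add_shift m B) = Xp c * pcompose Q (Xp d))
       \<or> (\<exists>c a. mset_poly (add_shift m B) = Xp c * F1 a m \<or> mset_poly (add_shift m B) = Xp c * F2 a m)"
proof -
  have inj: "B = M" if "image_mset int B = image_mset int M" for M
    using arg_cong[OF that, of "image_mset nat"] by (simp add: multiset.map_comp comp_def)
  have nonneg: "z \<ge> 0" if "z \<in># image_mset int B" for z using that by auto
  have pcompose_Xp: "pcompose (Xp k) (Xp d) = Xp (k * d)" for k d
    by (induction k) (simp_all add: monom_Suc pcompose_pCons mult_monom monom_0)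
  have pcompose_one: "pcompose 1 q = (1 :: nat poly)" for q
    by (simp add: one_pCons)
  have eq': "add_shift (int m) (image_mset int B) = add_shift (int n) (image_mset int D)"
    by (simp add: eq flip: image_int_add_shift)
  show ?thesis
  proof (rule balanced_5[OF _ _ eq'])
    fix ks z d
    assume d: "d > 0" and B: "image_mset int B = image_mset (\<lambda>k. z + k * d) (mset ks)"
      and ks: "int m = d \<and> ks \<in> {[0, 2, 4, 6, 8], [0, 4, 6, 8, 12]} \<or> int m = 3 * d \<and> ks = [0, 2, 4, 6, 8]"
    \<comment> \<open>Every admissible \<open>ks\<close> contains \<open>0\<close>, so
      \<open>z\<close> itself is an exponent.\<close>
    have "z \<ge> 0" using ks by (intro nonneg) (auto simp: B)
    then obtain c e where ce: "z = int c" "d = int e" using d by (metis nonneg_int_cases less_imp_le)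
    then consider "m = e" "B = {#c, c + 2 * e, c + 4 * e, c + 6 * e, c + 8 * e#}"
      | "m = e" "B = {#c, c + 4 * e, c + 6 * e, c + 8 * e, c + 12 * e#}"
      | "m = 3 * e" "B = {#c, c + 2 * e, c + 4 * e, c + 6 * e, c + 8 * e#}"
      using ks B inj by (auto simp: mult.commute)
    then have "\<exists>Q \<in> {Q1, Q2, Q3}. mset_poly (add_shift m B) = Xp c * pcompose Q (Xp e)"
      by cases (auto simp: Q1_def Q2_def Q3_def pcompose_mult pcompose_add pcompose_one pcompose_Xp
        mult_monom algebra_simps simp flip: binomial_mult_mset_poly)
    moreover have "e \<ge> 1" using d ce by simp
    ultimately show ?thesis by blast
  next
    fix z a
    assume a: "a \<ge> 0" and B: "image_mset int B =
      {#z, z + a, z + a + 2 * int m, z + 3 * int m, z + a + 4 * int m#}"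
    have "z \<ge> 0" by (intro nonneg) (auto simp: B)
    then obtain c e where "z = int c" "a = int e" using a by (metis nonneg_int_cases)
    then have "B = {#c, c + e, c + e + 2 * m, c + 3 * m, c + e + 4 * m#}"
      using B by (intro inj) auto
    then have "mset_poly (add_shift m B) = Xp c * F1 e m"
      by (simp add: F1_def mult_monom algebra_simps flip: binomial_mult_mset_poly)
    then show ?thesis by blast
  next
    fix z a
    assume a: "a \<ge> 0" and B: "image_mset int B =
      {#z, z + a, z + 2 * int m, z + a + 3 * int m, z + 4 * int m#}"
    have "z \<ge> 0" by (intro nonneg) (auto simp: B)
    then obtain c e where "z = int c" "a = int e" using a by (metis nonneg_int_cases)
    then have "B = {#c, c + e, c + 2 * m, c + e + 3 * m, c + 4 * m#}"
      using B by (intro inj) auto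
    then have "mset_poly (add_shift m B) = Xp c * F2 e m"
      by (simp add: F2_def mult_monom algebra_simps flip: binomial_mult_mset_poly)
    then show ?thesis by blast
  qed (use assms in auto)
qed

section \<open>Irreducible factors and the power of \<open>X\<close>\<close>

lemma divide_by_X:
  assumes "coeff x 0 = 0"
  shows "\<exists>y. x = Xp 1 * y"
proof -
  obtain a q where x: "x = pCons a q" by (cases x)
  have "Xp 1 = pCons 0 1"
    using monom_Suc[of "1 :: nat" 0] by (simp add: One_nat_def monom_0 one_pCons)
  then have "x = Xp 1 * q" using assms by (simp add: x)
  then show ?thesis ..
qed

lemma Xp_1_neq_1: "Xp 1 \<noteq> 1"
proof
  assume "Xp 1 = 1"
  then have "coeff (Xp 1) 0 = coeff 1 0" by (rule arg_cong)
  then show False by simp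
qed

text \<open>An irreducible other than \<open>X\<close> is not divisible by \<open>X\<close>. A
  single monomial with nonzero constant term would be \<open>1\<close>, so there are at least two
  monomials.\<close>

lemma N1_irreducible_const_term:
  assumes "N1_irreducible x" "x \<noteq> Xp 1"
  shows "coeff x 0 > 0" "poly x 1 \<ge> 2"
proof -
  show c: "coeff x 0 > 0"
  proof (rule ccontr)
    assume "\<not> coeff x 0 > 0"
    then obtain y where y: "x = Xp 1 * y" using divide_by_X by auto
    then have "y = 1" using assms Xp_1_neq_1 unfolding N1_irreducible_def by metis
    then show False using y assms by simp
  qed
  obtain M where M: "x = mset_poly M" using mset_poly_surj by blast
  have "size M \<noteq> 1"
  proof
    assume "size M = 1"
    then obtain k where "M = {#k#}" by (metis size_1_singleton_mset)
    then show False using assms c by (auto simp: M N1_irreducible_def split: if_splits)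
  qed
  moreover have "size M \<noteq> 0" using c M by auto
  ultimately show "poly x 1 \<ge> 2" unfolding M poly_mset_poly_1 by linarith
qed

lemma coeff_0_prod_mset: "coeff (prod_mset A) 0 = (\<Prod>x\<in>#A. coeff x 0)"
  by (induction A) (auto simp: coeff_mult_0)

definition non_X_factors :: "nat poly multiset \<Rightarrow> nat poly multiset" where
  "non_X_factors A = filter_mset (\<lambda>x. x \<noteq> Xp 1) A"

lemma Xp_power: "Xp 1 ^ c = Xp c"
  by (simp add: monom_power)

lemma split_X:
  "A = replicate_mset (count A (Xp 1)) (Xp 1) + non_X_factors A"
  "prod_mset A = Xp (count A (Xp 1)) * prod_mset (non_X_factors A)"
proof -
  show 1: "A = replicate_mset (count A (Xp 1)) (Xp 1) + non_X_factors A"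
    unfolding non_X_factors_def by (metis filter_eq_replicate_mset multiset_partition)
  show "prod_mset A = Xp (count A (Xp 1)) * prod_mset (non_X_factors A)"
    by (subst 1) (simp only: prod_mset_Un prod_mset_replicate_mset Xp_power)
qed

lemma X_part_unique:
  assumes "Xp c * p = Xp d * q" "coeff p 0 \<noteq> 0" "coeff q 0 \<noteq> 0"
  shows "c = d" "p = q"
proof -
  have "d \<le> c" using arg_cong[OF assms(1), of "\<lambda>p. coeff p c"] assms(2)
    by (auto simp: coeff_monom_mult split: if_splits)
  moreover have "c \<le> d" using arg_cong[OF assms(1), of "\<lambda>p. coeff p d"] assms(3)
    by (auto simp: coeff_monom_mult split: if_splits)
  ultimately show "c = d" by simp
  then show "p = q" using assms(1) by simp
qed

section \<open>Factorisations of polynomials with value 10 at 1\<close>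

lemma product_ten:
  fixes x y t :: nat
  assumes "x \<ge> 2" "y \<ge> 2" "x * (y * t) = 10"
  shows "t = 1" "x = 2 \<and> y = 5 \<or> x = 5 \<and> y = 2"
proof -
  have "t \<noteq> 0" using assms(3) by (cases "t = 0") simp_all
  then have "x * y \<le> 10" using assms(3)
    by (metis le_square mult.assoc mult_le_mono2 mult.right_neutral One_nat_def Suc_leI neq0_conv)
  moreover have "x * 2 \<le> x * y" "2 * y \<le> x * y" using assms(1,2) by simp_all
  ultimately have "x \<le> 5" "y \<le> 5" by linarith+
  then have "x \<in> {2, 3, 4, 5}" "y \<in> {2, 3, 4, 5}" using assms(1,2) by auto
  then have "t = 1 \<and> (x = 2 \<and> y = 5 \<or> x = 5 \<and> y = 2)"
    using assms(3) by (elim insertE emptyE; simp; presburger)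
  then show "t = 1" "x = 2 \<and> y = 5 \<or> x = 5 \<and> y = 2" by blast+
qed

text \<open>Each factor contributes at least 2 to the value 10 at 1, which is a product of only two
  primes.\<close>

lemma factors_of_ten:
  fixes A :: "nat poly multiset"
  assumes "\<And>x. x \<in># A \<Longrightarrow> poly x 1 \<ge> 2" "poly (prod_mset A) 1 = 10"
  obtains x where "A = {#x#}" | x y where "A = {#x, y#}" "poly x 1 = 2" "poly y 1 = 5"
proof -
  have "A \<noteq> {#}" using assms(2) by auto
  then obtain x A' where A: "A = add_mset x A'" by (meson multiset_cases)
  show thesis
  proof (cases "A' = {#}")
    case False
    then obtain y A'' where A': "A' = add_mset y A''" by (meson multiset_cases)
    have xy: "poly x 1 \<ge> 2" "poly y 1 \<ge> 2" "poly x 1 * (poly y 1 * poly (prod_mset A'') 1) = 10"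
      using assms by (auto simp: A A')
    have "A'' = {#}"
    proof (rule ccontr)
      assume "A'' \<noteq> {#}"
      then obtain z C where C: "A'' = add_mset z C" by (meson multiset_cases)
      have "poly z 1 * poly (prod_mset C) 1 = 1" using product_ten(1)[OF xy] by (simp add: C)
      moreover have "poly z 1 \<ge> 2" using assms(1) by (simp add: A A' C)
      ultimately show False by simp
    qed
    then show thesis
      using product_ten(2)[OF xy] that(2)[of x y] that(2)[of y x] by (auto simp: A A' add_mset_commute)
  qed (use A that(1) in auto)
qed

lemma two_term_poly:
  assumes "poly x 1 = (2 :: nat)" "coeff x 0 > 0"
  shows "\<exists>m. x = 1 + Xp m"
proof -
  obtain M where M: "x = mset_poly M" using mset_poly_surj by blast
  then have "0 \<in># M" using assms(2) by simp
  then obtain M' where M': "M = add_mset 0 M'" by (metis multi_member_split)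
  then have "size M' = 1" using assms(1) M by simp
  then obtain m where "M' = {#m#}" by (metis size_1_singleton_mset)
  then show ?thesis by (auto simp: M M' monom_0 simp flip: one_pCons)
qed

text \<open>Both factorisations must be of type \<open>2 * 5\<close>. The factor with value 2 is
  \<open>1 + X^m\<close> in one and \<open>1 + X^n\<close> in the other, and equality of the
  products is the balance condition.\<close>

lemma different_factorisations_balanced:
  assumes A: "\<And>x. x \<in># A \<Longrightarrow> N1_irreducible x \<and> x \<noteq> Xp 1"
    and A': "\<And>x. x \<in># A' \<Longrightarrow> N1_irreducible x \<and> x \<noteq> Xp 1"
    and eq: "prod_mset A = prod_mset A'" "A \<noteq> A'" and ten: "poly (prod_mset A) 1 = 10"
  obtains m n B D where "0 < m" "m < n" "add_shift m B = add_shift n D" "size B = 5"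
    "prod_mset A = mset_poly (add_shift m B)"
proof -
  have shape: "(\<exists>x. A = {#x#}) \<or> (\<exists>m B. A = {#1 + Xp m, mset_poly B#} \<and> size B = 5)"
    if "\<And>x. x \<in># A \<Longrightarrow> N1_irreducible x \<and> x \<noteq> Xp 1" "poly (prod_mset A) 1 = 10" for A
  proof (rule factors_of_ten[OF _ that(2)])
    fix x y assume xy: "A = {#x, y#}" "poly x 1 = 2" "poly y 1 = 5"
    then have "N1_irreducible x" "x \<noteq> Xp 1" using that(1)[of x] by auto
    then have "coeff x 0 > 0" by (rule N1_irreducible_const_term(1))
    from two_term_poly[OF xy(2) this] obtain m where "x = 1 + Xp m" ..
    moreover obtain B where "y = mset_poly B" using mset_poly_surj by blast
    ultimately show ?thesis using xy by auto
  qed (use N1_irreducible_const_term(2) that(1) in blast)+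
  \<comment> \<open>If one factorisation were a single irreducible, the other would be the same one
    or would split it properly.\<close>
  have two: "\<exists>m B. A = {#1 + Xp m, mset_poly B#} \<and> size B = 5"
    if A: "\<And>x. x \<in># A \<Longrightarrow> N1_irreducible x \<and> x \<noteq> Xp 1"
    and A': "\<And>x. x \<in># A' \<Longrightarrow> N1_irreducible x \<and> x \<noteq> Xp 1"
    and eq: "prod_mset A = prod_mset A'" "A \<noteq> A'" and ten: "poly (prod_mset A) 1 = 10" for A A'
  proof (rule ccontr)
    assume "\<not> ?thesis"
    then obtain x where x: "A = {#x#}" using shape[OF A ten] by blast
    with eq have "A' \<noteq> {#y#}" for y by auto
    then obtain y z where yz: "A' = {#y, z#}" using shape[OF A'] ten eq(1) by metis
    then have "x = y * z" "N1_irreducible x" "N1_irreducible y" "N1_irreducible z"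
      using x eq(1) A[of x] A'[of y] A'[of z] by simp_all
    then show False unfolding N1_irreducible_def by blast
  qed
  obtain m B where mB: "A = {#1 + Xp m, mset_poly B#}" "size B = 5"
    using two[OF A A' eq ten] by blast
  obtain n D where nD: "A' = {#1 + Xp n, mset_poly D#}" "size D = 5"
    using two[OF A' A eq(1)[symmetric] eq(2)[symmetric]] ten eq(1) by auto
  have bal: "add_shift m B = add_shift n D"
    using eq(1) by (simp add: mB nD binomial_mult_mset_poly)
  have pr: "prod_mset A = mset_poly (add_shift m B)" "prod_mset A = mset_poly (add_shift n D)"
    by (simp_all add: eq(1) mB(1) nD(1) binomial_mult_mset_poly bal)
  have "m \<noteq> n" using eq(2) bal by (auto simp: mB nD add_shift_inject)
  moreover have "m \<noteq> 0"
  proof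
    assume "m = 0"
    with \<open>m \<noteq> n\<close> bal have "even (size D)" by (intro even_size_if_add_shift_0[of n B D]) auto
    then show False by (simp add: nD(2))
  qed
  moreover have "n \<noteq> 0"
  proof
    assume "n = 0"
    with \<open>m \<noteq> n\<close> bal have "even (size B)" by (intro even_size_if_add_shift_0[of m D B]) auto
    then show False by (simp add: mB(2))
  qed
  \<comment> \<open>The situation is symmetric, so the pair with the smaller shift takes the role of
    \<open>m\<close> and \<open>B\<close>.\<close>
  ultimately consider "0 < m" "m < n" | "0 < n" "n < m" by linarith
  then show thesis
    by cases (use that[of m n B D] that[of n m D B] bal pr mB(2) nD(2) in auto)
qed

theorem mainTheorem12:
  fixes P :: "nat poly"
  assumes "poly P 1 = 10"
    and "\<not> N1_unique_factorisation P"
  shows "(\<exists>c d Q. d \<ge> 1 \<and> Q \<in> {Q1, Q2, Q3} \<and> P = Xp c * pcompose Q (Xp d))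
       \<or> (\<exists>c a b. b \<ge> 1 \<and> (P = Xp c * F1 a b \<or> P = Xp c * F2 a b))"
proof -
  obtain A A' where A: "\<And>x. x \<in># A \<Longrightarrow> N1_irreducible x" "prod_mset A = P"
    and A': "\<And>x. x \<in># A' \<Longrightarrow> N1_irreducible x" "prod_mset A' = P" and ne: "A \<noteq> A'"
    using assms(2) unfolding N1_unique_factorisation_def by blast
  have const: "coeff (prod_mset (non_X_factors B)) 0 \<noteq> 0" if "\<And>x. x \<in># B \<Longrightarrow> N1_irreducible x" for B
  proof -
    have "coeff x 0 \<noteq> 0" if "x \<in># non_X_factors B" for x
      using that \<open>\<And>x. x \<in># B \<Longrightarrow> N1_irreducible x\<close> N1_irreducible_const_term(1)[of x]
      by (auto simp: non_X_factors_def)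
    then show ?thesis by (auto simp: coeff_0_prod_mset simp del: neq0_conv)
  qed
  define c where "c = count A (Xp 1)"
  have P: "P = Xp c * prod_mset (non_X_factors A)" "P = Xp (count A' (Xp 1)) * prod_mset (non_X_factors A')"
    using split_X(2)[of A] split_X(2)[of A'] A(2) A'(2) by (simp_all add: c_def)
  \<comment> \<open>Both the powers of \<open>X\<close> and the products of the remaining factors
    agree, so the factorisations already differ in the factors other than \<open>X\<close>.\<close>
  note X = X_part_unique[OF P(1)[symmetric, unfolded P(2)] const[OF A(1)] const[OF A'(1)]]
  have "non_X_factors A \<noteq> non_X_factors A'"
    using split_X(1)[of A] split_X(1)[of A'] ne X(1) by (metis c_def)
  moreover have "poly (prod_mset (non_X_factors A)) 1 = 10"
    using assms(1) P(1) by (simp add: poly_monom)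
  moreover have "N1_irreducible x \<and> x \<noteq> Xp 1"
    if "x \<in># non_X_factors A \<or> x \<in># non_X_factors A'" for x
    using that A(1) A'(1) by (auto simp: non_X_factors_def)
  ultimately obtain m n B D where mn: "0 < m" "m < n" "add_shift m B = add_shift n D" "size B = 5"
    and R: "prod_mset (non_X_factors A) = mset_poly (add_shift m B)"
    using X(2) different_factorisations_balanced[of "non_X_factors A" "non_X_factors A'"] by metis
  have shift: "Xp c * (Xp c' * F) = Xp (c + c') * F" for c' F
    by (simp add: mult_monom flip: mult.assoc)
  from mset_poly_balanced_5[OF mn] show ?thesis
  proof (elim disjE exE conjE)
    fix c' d Q assume "1 \<le> d" "Q \<in> {Q1, Q2, Q3}" "mset_poly (add_shift m B) = Xp c' * pcompose Q (Xp d)"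
    then show ?thesis using P(1) R shift by metis
  next
    fix c' a assume "mset_poly (add_shift m B) = Xp c' * F1 a m"
    then show ?thesis using P(1) R shift mn(1) by (metis One_nat_def Suc_leI)
  next
    fix c' a assume "mset_poly (add_shift m B) = Xp c' * F2 a m"
    then show ?thesis using P(1) R shift mn(1) by (metis One_nat_def Suc_leI)
  qed
qed

end
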